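(* Let $f:\mathbb{N}\to\mathbb{R}_{\ge 0}$ be a non-negative arithmetic function and let $M\in\mathbb{N}$ be such that $\bigl(\mathrm{fix}^r(f)\bigr)_M\neq 0$ for some $r\in\mathbb{N}$. Then $$\lim_{n\to\infty}\frac{\bigl(\mathrm{fix}^{n+1}(f)\bigr)_M}{\bigl(\mathrm{fix}^{n}(f)\bigr)_M}=M.$$
   Context: $\mathbb{N}=\{1,2,3,\ldots\}$. An arithmetic function is a function $f:\mathbb{N}\to\mathbb{C}$, with values written $f_n$ or $f(n)$. The map $\mathrm{fix}$ sends an arithmetic function $f$ to the arithmetic function $\mathrm{fix}(f)$ given by $\mathrm{fix}(f)_n=\sum_{d\mid n}d\,f_d$ for $n\in\mathbb{N}$ (sum over positive divisors of $n$); $\mathrm{fix}^n$ denotes its $n$-fold iterate. *)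

theory Defs
  imports "HOL-Analysis.Analysis"
begin

(* An arithmetic function is a function "nat \<Rightarrow> complex" of which only the values at positive
   arguments matter: for n > 0 the set of divisors below is finite and does not contain 0.
   The set is infinite for n = 0, so the value of "fix_map f" there is the dummy 0.
   The name "fix" itself is an Isar keyword. *)
definition fix_map :: "(nat \<Rightarrow> complex) \<Rightarrow> nat \<Rightarrow> complex" where
  "fix_map f n = (\<Sum>d | d dvd n. of_nat d * f d)"

end

theory Submission
  imports Defs
begin

text \<open>Put \<open>b n m = (fix_map ^^ n) f m / m ^ n\<close>. The increment \<open>b (Suc n) m - b n m\<close> is a combination
  of the terms \<open>(d / m) ^ n * b n d\<close> over the proper divisors \<open>d\<close> of \<open>m\<close>. By strong induction each
  \<open>b n d\<close> is bounded in \<open>n\<close>, so the increments decay geometrically and \<open>b n m\<close> converges. If \<open>f\<close> is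
  non-negative then \<open>b n m\<close> is nondecreasing in \<open>n\<close>, so its limit is nonzero as soon as one term is,
  and the quotient of consecutive iterates, \<open>m * b (Suc n) m / b n m\<close>, tends to \<open>m\<close>.\<close>

lemma fix_map_split:
  assumes "m > 0"
  shows "fix_map f m = of_nat m * f m + (\<Sum>d | d dvd m \<and> d \<noteq> m. of_nat d * f d)"
proof -
  have "{d. d dvd m} = insert m {d. d dvd m \<and> d \<noteq> m}"
    by auto
  moreover have "finite {d. d dvd m \<and> d \<noteq> m}"
    using assms by simp
  ultimately show ?thesis
    unfolding fix_map_def by simp
qed

lemma funpow_fix_map_nonneg:
  assumes "\<And>m. m \<ge> 1 \<Longrightarrow> f m \<in> \<real>\<^sub>\<ge>\<^sub>0" and "m \<ge> 1"
  shows "(fix_map ^^ n) f m \<in> \<real>\<^sub>\<ge>\<^sub>0"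
  using assms(2)
proof (induction n arbitrary: m)
  case 0
  then show ?case using assms by simp
next
  case (Suc n)
  \<comment> \<open>Divisors of a positive \<open>m\<close> are positive, so the induction
    hypothesis covers every summand.\<close>
  have "(fix_map ^^ n) f d \<in> \<real>\<^sub>\<ge>\<^sub>0" if "d dvd m" for d
    using that Suc by (auto intro!: Suc.IH Suc_leI intro: dvd_pos_nat)
  then show ?case
    unfolding funpow.simps comp_apply fix_map_def
    by (auto simp: complex_nonneg_Reals_iff intro!: sum_nonneg)
qed

text \<open>The divisor \<open>d = m\<close> contributes \<open>m\<close> times the previous
  iterate; dividing by \<open>m ^ Suc n\<close> turns this into the previous normalised value, which
  cancels.\<close>

lemma normalised_iterate_step:
  assumes "m > 0"
  shows "(fix_map ^^ Suc n) f m / of_nat m ^ Suc n - (fix_map ^^ n) f m / of_nat m ^ n =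
    (\<Sum>d | d dvd m \<and> d \<noteq> m. of_nat d * (fix_map ^^ n) f d) / of_nat m ^ Suc n"
  using assms by (simp add: fix_map_split add_divide_distrib)

lemma convergent_normalised_iterate:
  assumes "m > 0"
  shows "convergent (\<lambda>n. (fix_map ^^ n) f m / of_nat m ^ n)"
  using assms
proof (induction m rule: less_induct)
  case (less m)
  define b where "b d n = (fix_map ^^ n) f d / of_nat d ^ n" for d n
  have term_summable: "summable (\<lambda>n. of_nat d * (fix_map ^^ n) f d / of_nat m ^ Suc n)"
    if "d dvd m" "d \<noteq> m" for d
  proof -
    have "0 < d" "d < m"
      using that less.prems by (auto intro: dvd_pos_nat dest: dvd_imp_le)
    then have "Bseq (b d)"
      using less.IH unfolding b_def by (blast intro: convergent_imp_Bseq)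
    then obtain K where K: "\<And>n. norm (b d n) \<le> K"
      unfolding Bseq_def by blast
    \<comment> \<open>The ratio \<open>d / m\<close> is below 1 because \<open>d\<close> is a proper
      divisor.\<close>
    have "summable (\<lambda>n. (K * (d / m)) * (real d / real m) ^ n)"
      using \<open>d < m\<close> by (intro summable_mult summable_geometric) simp
    moreover have "norm (of_nat d * (fix_map ^^ n) f d / of_nat m ^ Suc n)
        \<le> (K * (d / m)) * (real d / real m) ^ n" for n
    proof -
      have "of_nat d * (fix_map ^^ n) f d / of_nat m ^ Suc n
          = b d n * of_real ((d / m) * (real d / real m) ^ n)"
        using \<open>0 < d\<close> less.prems by (simp add: b_def field_simps)
      then have "norm (of_nat d * (fix_map ^^ n) f d / of_nat m ^ Suc n)
          = norm (b d n) * ((d / m) * (real d / real m) ^ n)"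
        by (simp only: norm_mult norm_of_real) simp
      also have "\<dots> \<le> K * ((d / m) * (real d / real m) ^ n)"
        using K by (intro mult_right_mono) auto
      finally show ?thesis
        by (simp only: mult.assoc)
    qed
    ultimately show ?thesis
      by (rule summable_comparison_test')
  qed
  have "summable (\<lambda>n. \<Sum>d | d dvd m \<and> d \<noteq> m. of_nat d * (fix_map ^^ n) f d / of_nat m ^ Suc n)"
    using term_summable by (intro summable_sum) auto
  then have "summable (\<lambda>n. b m (Suc n) - b m n)"
    using less.prems
    by (simp only: b_def normalised_iterate_step sum_divide_distrib)
  \<comment> \<open>The partial sums telescope to \<open>b m n - b m 0\<close>; adding
    \<open>b m 0\<close> recovers the sequence itself.\<close>
  then have "convergent (\<lambda>n. (\<Sum>k<n. b m (Suc k) - b m k) + b m 0)"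
    by (intro convergent_add convergent_const) (simp add: summable_iff_convergent)
  moreover have "(\<Sum>k<n. b m (Suc k) - b m k) + b m 0 = b m n" for n
    by (subst sum_lessThan_telescope) simp
  ultimately show ?case
    by (simp add: b_def)
qed

text \<open>Each increment is a non-negative combination of iterates at proper divisors. As all
  values are real, passing to \<open>Re\<close> loses nothing and gives access to the order.\<close>

lemma incseq_Re_normalised_iterate:
  assumes "\<And>m. m \<ge> 1 \<Longrightarrow> f m \<in> \<real>\<^sub>\<ge>\<^sub>0" and "m > 0"
  shows "incseq (\<lambda>n. Re ((fix_map ^^ n) f m / of_nat m ^ n))"
proof (rule incseq_SucI)
  fix n
  have "(fix_map ^^ n) f d \<in> \<real>\<^sub>\<ge>\<^sub>0" if "d dvd m" for d
    using that assms by (intro funpow_fix_map_nonneg) (auto intro!: Suc_leI intro: dvd_pos_nat)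
  then have "0 \<le> Re (\<Sum>d | d dvd m \<and> d \<noteq> m. of_nat d * (fix_map ^^ n) f d)"
    by (auto simp: complex_nonneg_Reals_iff intro!: sum_nonneg)
  moreover have "Re (z / of_nat m ^ k) = Re z / real m ^ k" for z k
    by (metis Re_divide_of_nat of_nat_power)
  ultimately have "0 \<le> Re ((fix_map ^^ Suc n) f m / of_nat m ^ Suc n
      - (fix_map ^^ n) f m / of_nat m ^ n)"
    by (simp only: normalised_iterate_step[OF assms(2)]) simp
  then show "Re ((fix_map ^^ n) f m / of_nat m ^ n)
      \<le> Re ((fix_map ^^ Suc n) f m / of_nat m ^ Suc n)"
    by (simp only: minus_complex.sel)
qed

theorem theorem3p4:
  fixes f :: "nat \<Rightarrow> complex" and M r :: nat
  assumes "\<And>n. n \<ge> 1 \<Longrightarrow> f n \<in> \<real>\<^sub>\<ge>\<^sub>0"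
    and "M \<ge> 1"
    and "r \<ge> 1" and "(fix_map ^^ r) f M \<noteq> 0"
  shows "(\<lambda>n. (fix_map ^^ (n + 1)) f M / (fix_map ^^ n) f M) \<longlonglongrightarrow> of_nat M"
proof -
  define b where "b n = (fix_map ^^ n) f M / of_nat M ^ n" for n
  have "M > 0"
    using assms(2) by simp
  then obtain L where L: "b \<longlonglongrightarrow> L"
    using convergent_normalised_iterate unfolding b_def convergent_def by blast
  have "(fix_map ^^ r) f M \<in> \<real>\<^sub>\<ge>\<^sub>0"
    using assms(1,2) by (rule funpow_fix_map_nonneg)
  then have "0 < Re ((fix_map ^^ r) f M)"
    using assms(4) by (auto simp: complex_nonneg_Reals_iff complex_eq_iff)
  then have "0 < Re (b r)"
    using \<open>M > 0\<close> unfolding b_def by (metis Re_divide_of_nat of_nat_power divide_pos_pos of_nat_0_less_iff zero_less_power)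
  \<comment> \<open>A nondecreasing sequence stays below its limit, so the single positive term at
    \<open>r\<close> keeps \<open>L\<close> away from 0.\<close>
  also have "Re (b r) \<le> Re L"
    using incseq_Re_normalised_iterate[OF assms(1) \<open>M > 0\<close>] tendsto_Re[OF L]
    unfolding b_def by (rule incseq_le)
  finally have "L \<noteq> 0"
    by auto
  then have "(\<lambda>n. of_nat M * (b (Suc n) / b n)) \<longlonglongrightarrow> of_nat M * (L / L)"
    by (intro tendsto_intros LIMSEQ_Suc L)
  \<comment> \<open>This holds even where the \<open>n\<close>-th iterate vanishes at
    \<open>M\<close>: both quotients are then 0 by the convention \<open>x / 0 = 0\<close>.\<close>
  moreover have "of_nat M * (b (Suc n) / b n) = (fix_map ^^ (n + 1)) f M / (fix_map ^^ n) f M" for n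
    using \<open>M > 0\<close> by (simp add: b_def)
  ultimately show ?thesis
    using \<open>L \<noteq> 0\<close> by simp
qed

end
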